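(* Let $k$ be a field, $S = k[x_1,\ldots,x_n]$ with $n\ge1$, $I \subset S$ a proper homogeneous ideal, $d=\dim S/I$, and let $0\le i\le \min\{d,n-1\}$. Then $c_i(I) < \infty$ if and only if for every element $a \in p_{n-i}(E_i)\setminus E_{i+1}$ and every $j = 1,\ldots,n-i-1$ there is an element $b_j \in E_{i+1}$ such that $p_j(a) \ge p_j(b_j)$.
   Context: $\operatorname{in}(I)$ denotes the initial ideal of $I$ with respect to the (degree) reverse lexicographic order with $x_1>\cdots>x_n$. Put $S_i = k[x_1,\ldots,x_{n-i}]$. Let $J_i\subset S_i$ be the ideal obtained from $\operatorname{in}(I)$ by the evaluation $x_{n-i+1}=\cdots=x_n=0$; i.e. $J_i$ is generated by the monomial generators of $\operatorname{in}(I)$ not divisible by any of $x_{n-i+1},\ldots,x_n$. Let $\tilde J_i\subset S_i$ be the ideal of $S_i$ generated by the monomials obtained from those of $J_i$ by setting $x_{n-i}=1$ (so $J_i\subseteq\tilde J_i$). Define $c_i(I) := \sup\{r \mid (\tilde J_i/J_i)_r \neq 0\}$, with $c_i(I)=-\infty$ if $\tilde J_i=J_i$ (the value $\infty$ is allowed). Let $\mathcal B$ be the finite set of monomials minimally generating $\operatorname{in}(I)$. For $0\le m\le n$ set $E_m := \{v\in\mathbb N^{n-m} \mid x^v\in\mathcal B\}$, where $x^v = x_1^{\varepsilon_1}\cdots x_s^{\varepsilon_s}$ for $v=(\varepsilon_1,\ldots,\varepsilon_s)$; here $0 \in \mathbb N$. For any $s\ge1$ and $1\le j\le s$, $p_j:\mathbb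 N^s\to\mathbb N^{s-1}$ denotes the projection deleting the $j$th coordinate (so above $p_{n-i}$ acts on $\mathbb N^{n-i}$, while $p_j(a),p_j(b_j)$ are taken on $\mathbb N^{n-i-1}$). For vectors of the same size, $a\ge b$ means coordinatewise inequality. *)

theory Defs
  imports "HOL-Library.Poly_Mapping" "HOL-Library.Extended_Real" "HOL-Algebra.QuotRing"
begin

text \<open>
  A polynomial maps exponents (finitely supported functions from variable indices to
  \<^typ>\<open>nat\<close>) to coefficients; multiplication is the convolution product of
  \<^theory>\<open>HOL-Library.Poly_Mapping\<close>. The variable \<open>x\<^sub>k\<close> has index \<open>k\<close>, counted from 1.
\<close>

type_synonym 'k mpoly = "(nat \<Rightarrow>\<^sub>0 nat) \<Rightarrow>\<^sub>0 'k"

definition poly_ring :: "nat \<Rightarrow> ('k::field) mpoly ring" where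
  "poly_ring n =
     \<lparr>carrier = {p. \<forall>u\<in>Poly_Mapping.keys p. Poly_Mapping.keys u \<subseteq> {1..n}},
      monoid.mult = (*), one = 1, zero = 0, add = (+)\<rparr>"

definition monom :: "(nat \<Rightarrow>\<^sub>0 nat) \<Rightarrow> ('k::field) mpoly" where
  "monom u = Poly_Mapping.single u 1"

definition Var :: "nat \<Rightarrow> ('k::field) mpoly" where
  "Var k = monom (Poly_Mapping.single k 1)"

definition mon_degree :: "(nat \<Rightarrow>\<^sub>0 nat) \<Rightarrow> nat" where
  "mon_degree u = (\<Sum>k\<in>Poly_Mapping.keys u. Poly_Mapping.lookup u k)"

text \<open>The zero polynomial is homogeneous of every degree.\<close>

definition homogeneous :: "nat \<Rightarrow> ('k::field) mpoly \<Rightarrow> bool" where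
  "homogeneous r p \<longleftrightarrow> (\<forall>u\<in>Poly_Mapping.keys p. mon_degree u = r)"

definition homogeneous_ideal :: "nat \<Rightarrow> ('k::field) mpoly set \<Rightarrow> bool" where
  "homogeneous_ideal n I \<longleftrightarrow> ideal I (poly_ring n) \<and>
     (\<exists>H \<subseteq> carrier (poly_ring n). (\<forall>f\<in>H. \<exists>r. homogeneous r f) \<and> I = Idl\<^bsub>poly_ring n\<^esub> H)"

text \<open>
  Krull dimension: a list of \<open>l + 1\<close> primes is a chain of length \<open>l\<close>. The zero ring has
  dimension \<open>-\<infinity>\<close>.
\<close>

definition krull_dim :: "('a, 'b) ring_scheme \<Rightarrow> ereal" where
  "krull_dim R = (SUP l \<in> {l. \<exists>Ps. length Ps = Suc l \<and> sorted_wrt (\<subset>) Ps \<and>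
                                   (\<forall>P\<in>set Ps. primeideal P R)}. ereal (real l))"

text \<open>
  Degree reverse lexicographic order with \<open>x\<^sub>1 > x\<^sub>2 > \<dots>\<close>: among exponents of the same degree,
  the smaller one has the larger entry at the last place where they differ.
\<close>

definition drl_less :: "(nat \<Rightarrow>\<^sub>0 nat) \<Rightarrow> (nat \<Rightarrow>\<^sub>0 nat) \<Rightarrow> bool" where
  "drl_less u v \<longleftrightarrow> mon_degree u < mon_degree v \<or>
     (mon_degree u = mon_degree v \<and>
      (\<exists>k. Poly_Mapping.lookup u k > Poly_Mapping.lookup v k \<and>
           (\<forall>l>k. Poly_Mapping.lookup u l = Poly_Mapping.lookup v l)))"

text \<open>Meaningful only for nonzero polynomials.\<close>

definition lead_exp :: "('k::field) mpoly \<Rightarrow> (nat \<Rightarrow>\<^sub>0 nat)" where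
  "lead_exp f = (THE u. u \<in> Poly_Mapping.keys f \<and>
                        (\<forall>v\<in>Poly_Mapping.keys f. v \<noteq> u \<longrightarrow> drl_less v u))"

definition initial_ideal :: "nat \<Rightarrow> ('k::field) mpoly set \<Rightarrow> 'k mpoly set" where
  "initial_ideal n I = Idl\<^bsub>poly_ring n\<^esub> {monom (lead_exp f) | f. f \<in> I \<and> f \<noteq> 0}"

definition substitute :: "(nat \<Rightarrow> 'k mpoly) \<Rightarrow> ('k::field) mpoly \<Rightarrow> 'k mpoly" where
  "substitute \<sigma> p = (\<Sum>u\<in>Poly_Mapping.keys p.
     Poly_Mapping.single 0 (Poly_Mapping.lookup p u) *
     (\<Prod>k\<in>Poly_Mapping.keys u. \<sigma> k ^ Poly_Mapping.lookup u k))"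

definition monomials :: "nat \<Rightarrow> ('k::field) mpoly set" where
  "monomials n = {monom u | u. Poly_Mapping.keys u \<subseteq> {1..n}}"

text \<open>\<open>J_ideal n I i\<close> and \<open>J_tilde n I i\<close> are ideals of \<open>S\<^sub>i = poly_ring (n - i)\<close>.\<close>

definition J_ideal :: "nat \<Rightarrow> ('k::field) mpoly set \<Rightarrow> nat \<Rightarrow> 'k mpoly set" where
  "J_ideal n I i = Idl\<^bsub>poly_ring (n - i)\<^esub>
     (substitute (\<lambda>k. if n - i < k then 0 else Var k) ` initial_ideal n I)"

definition J_tilde :: "nat \<Rightarrow> ('k::field) mpoly set \<Rightarrow> nat \<Rightarrow> 'k mpoly set" where
  "J_tilde n I i = Idl\<^bsub>poly_ring (n - i)\<^esub>
     (substitute (\<lambda>k. if k = n - i then 1 else Var k) ` (J_ideal n I i \<inter> monomials (n - i)))"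

text \<open>
  The degree \<open>r\<close> component of \<open>K / L\<close> for homogeneous ideals \<open>L \<subseteq> K\<close> of \<open>R\<close>, as a set of cosets
  of \<open>L\<close>; it is zero iff it equals \<open>{L}\<close>.
\<close>

definition quot_component ::
  "('k::field) mpoly ring \<Rightarrow> 'k mpoly set \<Rightarrow> 'k mpoly set \<Rightarrow> nat \<Rightarrow> 'k mpoly set set" where
  "quot_component R K L r = {L +>\<^bsub>R\<^esub> f | f. f \<in> K \<and> homogeneous r f}"

text \<open>The supremum of the empty set in \<^typ>\<open>ereal\<close> is \<open>-\<infinity>\<close>.\<close>

definition c_inv :: "nat \<Rightarrow> ('k::field) mpoly set \<Rightarrow> nat \<Rightarrow> ereal" where
  "c_inv n I i = (SUP r \<in> {r. quot_component (poly_ring (n - i)) (J_tilde n I i) (J_ideal n I i) r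
                          \<noteq> {J_ideal n I i}}. ereal (real r))"

definition min_generators :: "nat \<Rightarrow> ('k::field) mpoly set \<Rightarrow> 'k mpoly set" where
  "min_generators n L = (THE B. finite B \<and> B \<subseteq> monomials n \<and> Idl\<^bsub>poly_ring n\<^esub> B = L \<and>
                                (\<forall>C. C \<subset> B \<longrightarrow> Idl\<^bsub>poly_ring n\<^esub> C \<noteq> L))"

text \<open>
  Elements of \<open>\<nat>\<^sup>s\<close> are lists of length \<open>s\<close>. List positions count from 0, whereas coordinates
  and variables count from 1.
\<close>

definition xpow :: "nat list \<Rightarrow> ('k::field) mpoly" where
  "xpow v = (\<Prod>k=1..length v. Var k ^ (v ! (k - 1)))"

definition E_set :: "nat \<Rightarrow> ('k::field) mpoly set \<Rightarrow> nat \<Rightarrow> nat list set" where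
  "E_set n I m = {v. length v = n - m \<and> xpow v \<in> min_generators n (initial_ideal n I)}"

definition proj :: "nat \<Rightarrow> nat list \<Rightarrow> nat list" where
  "proj j v = take (j - 1) v @ drop j v"

definition vec_le :: "nat list \<Rightarrow> nat list \<Rightarrow> bool" where
  "vec_le b a \<longleftrightarrow> list_all2 (\<le>) b a"

end

theory Submission imports Defs begin

text \<open>
  Only the fact that the initial ideal is a monomial ideal matters. Write \<open>W\<close> for its set of
  exponents and \<open>s = n - i\<close>. If \<open>c_inv\<close> is finite and \<open>a\<close> is the projection of a generator, then
  \<open>x\<^sup>a x\<^sub>j\<^sup>N\<close> lies in \<open>J\<close> for large \<open>N\<close>, and a generator dividing it is the required \<open>b\<^sub>j\<close>.
  Conversely let \<open>x\<^sup>u\<close> be a monomial of \<open>J_tilde\<close> outside \<open>J\<close>; it lies above the projection \<open>a\<close>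
  of a generator \<open>g\<close>. If \<open>u\<^sub>j\<close> exceeded all exponents occurring in the finitely many minimal
  generators, then \<open>b\<^sub>j\<close> (or \<open>g\<close>, if \<open>j = s\<close>) would divide \<open>x\<^sup>u\<close>; so all coordinates of \<open>u\<close>
  are bounded.
\<close>

section \<open>Exponent vectors under divisibility, and sets closed under multiples\<close>

definition exponents :: "nat \<Rightarrow> (nat \<Rightarrow>\<^sub>0 nat) set" where
  "exponents n = {u. Poly_Mapping.keys u \<subseteq> {1..n}}"

definition exp_le :: "(nat \<Rightarrow>\<^sub>0 nat) \<Rightarrow> (nat \<Rightarrow>\<^sub>0 nat) \<Rightarrow> bool" where
  "exp_le u v \<longleftrightarrow> (\<forall>k. Poly_Mapping.lookup u k \<le> Poly_Mapping.lookup v k)"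

text \<open>The equation \<open>up_closure n W = W\<close> packs two facts into one:
  \<open>W\<close> involves only the variables 1 to \<open>n\<close>, and it is closed under
  multiples in those variables. It serves throughout as the description of a monomial ideal by its
  exponents.\<close>

definition up_closure :: "nat \<Rightarrow> (nat \<Rightarrow>\<^sub>0 nat) set \<Rightarrow> (nat \<Rightarrow>\<^sub>0 nat) set" where
  "up_closure n U = {v \<in> exponents n. \<exists>u\<in>U. exp_le u v}"

definition min_exps :: "(nat \<Rightarrow>\<^sub>0 nat) set \<Rightarrow> (nat \<Rightarrow>\<^sub>0 nat) set" where
  "min_exps W = {u \<in> W. \<forall>v\<in>W. exp_le v u \<longrightarrow> v = u}"

text \<open>Only a linear span, independent of any number of variables. With
  \<open>W = exponents n\<close> it is the carrier of the polynomial ring, with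
  \<open>up_closure n W = W\<close> a monomial ideal, so ideals and subrings share one membership
  calculus.\<close>

definition monomial_span :: "(nat \<Rightarrow>\<^sub>0 nat) set \<Rightarrow> ('k::field) mpoly set" where
  "monomial_span W = {p. Poly_Mapping.keys p \<subseteq> W}"

lemma exp_le_refl [simp]: "exp_le u u"
  by (simp add: exp_le_def)

lemma exp_le_trans: "exp_le u v \<Longrightarrow> exp_le v w \<Longrightarrow> exp_le u w"
  unfolding exp_le_def using order_trans by blast

lemma exp_le_iff_add: "exp_le u v \<longleftrightarrow> (\<exists>w. v = w + u)"
proof
  assume "exp_le u v"
  then have "v = (v - u) + u"
    by (auto simp: exp_le_def lookup_add lookup_minus intro!: poly_mapping_eqI)
  then show "\<exists>w. v = w + u" ..
qed (auto simp: exp_le_def lookup_add)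

lemma exponents_iff: "u \<in> exponents n \<longleftrightarrow> (\<forall>k. k \<notin> {1..n} \<longrightarrow> Poly_Mapping.lookup u k = 0)"
  by (auto simp: exponents_def in_keys_iff)

lemma exponents_add_iff: "u + v \<in> exponents n \<longleftrightarrow> u \<in> exponents n \<and> v \<in> exponents n"
  by (auto simp: exponents_iff lookup_add)

lemma exponents_mono: "m \<le> n \<Longrightarrow> exponents m \<subseteq> exponents n"
  by (auto simp: exponents_def)

lemma exponents_downward: "exp_le u v \<Longrightarrow> v \<in> exponents n \<Longrightarrow> u \<in> exponents n"
  by (auto simp: exp_le_iff_add exponents_add_iff)

lemma up_closure_subset: "up_closure n U \<subseteq> exponents n"
  by (auto simp: up_closure_def)

lemma up_closure_superset: "U \<subseteq> exponents n \<Longrightarrow> U \<subseteq> up_closure n U"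
  by (auto simp: up_closure_def intro: exp_le_refl)

lemma up_closure_upward: "u \<in> up_closure n U \<Longrightarrow> exp_le u v \<Longrightarrow> v \<in> exponents n \<Longrightarrow> v \<in> up_closure n U"
  unfolding up_closure_def using exp_le_trans by blast

lemma up_closure_idem: "up_closure n (up_closure n U) = up_closure n U"
proof
  show "up_closure n U \<subseteq> up_closure n (up_closure n U)"
    by (rule up_closure_superset[OF up_closure_subset])
  show "up_closure n (up_closure n U) \<subseteq> up_closure n U"
    unfolding up_closure_def using exp_le_trans by blast
qed

section \<open>Monomial spans and monomial ideals of the polynomial ring\<close>

lemma keys_monom [simp]: "Poly_Mapping.keys (monom u :: ('k::field) mpoly) = {u}"
  by (simp add: monom_def)

lemma monom_eq_iff [simp]: "(monom u :: ('k::field) mpoly) = monom v \<longleftrightarrow> u = v"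
  by (metis keys_monom singleton_inject)

lemma monomials_eq: "monomials n = monom ` exponents n"
  by (auto simp: monomials_def exponents_def)

lemma monom_in_monomial_span [simp]: "monom u \<in> monomial_span W \<longleftrightarrow> u \<in> W"
  by (simp add: monomial_span_def)

lemma monomial_span_eq_iff:
  "(monomial_span V :: ('k::field) mpoly set) = monomial_span W \<longleftrightarrow> V = W"
  using monom_in_monomial_span[where ?'a = 'k] by (metis subsetI subset_antisym)

lemma carrier_poly_ring: "carrier (poly_ring n) = monomial_span (exponents n)"
  by (auto simp: poly_ring_def monomial_span_def exponents_def)

lemma poly_ring_simps [simp]:
  "f \<otimes>\<^bsub>poly_ring n\<^esub> g = f * g" "\<one>\<^bsub>poly_ring n\<^esub> = 1"
  "\<zero>\<^bsub>poly_ring n\<^esub> = 0" "f \<oplus>\<^bsub>poly_ring n\<^esub> g = f + g"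
  by (simp_all add: poly_ring_def)

lemma monomial_span_zero [simp]: "0 \<in> monomial_span W"
  by (simp add: monomial_span_def)

lemma monomial_span_add:
  "f \<in> monomial_span W \<Longrightarrow> g \<in> monomial_span W \<Longrightarrow> f + g \<in> monomial_span W"
  using keys_add[of f g] by (auto simp: monomial_span_def)

lemma monomial_span_uminus: "f \<in> monomial_span W \<Longrightarrow> - f \<in> monomial_span W"
  by (auto simp: monomial_span_def in_keys_iff)

lemma monomial_span_mult:
  assumes "f \<in> monomial_span V" "g \<in> monomial_span W" "\<And>v w. v \<in> V \<Longrightarrow> w \<in> W \<Longrightarrow> v + w \<in> U"
  shows "f * g \<in> monomial_span U"
  using assms keys_mult[of f g] unfolding monomial_span_def by blast

lemma poly_ring_cring: "cring (poly_ring n :: ('k::field) mpoly ring)"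
proof (rule cringI)
  show "abelian_group (poly_ring n :: 'k mpoly ring)"
  proof (rule abelian_groupI)
    fix x assume "x \<in> carrier (poly_ring n :: 'k mpoly ring)"
    then show "\<exists>y\<in>carrier (poly_ring n). y \<oplus>\<^bsub>poly_ring n\<^esub> x = \<zero>\<^bsub>poly_ring n\<^esub>"
      by (intro bexI[of _ "- x"]) (auto simp: carrier_poly_ring monomial_span_uminus)
  qed (auto simp: carrier_poly_ring monomial_span_add add_ac)
  show "Group.comm_monoid (poly_ring n :: 'k mpoly ring)"
    by (rule comm_monoidI)
      (auto simp: carrier_poly_ring mult_ac exponents_add_iff intro: monomial_span_mult,
       simp add: monomial_span_def exponents_def)
qed (auto simp: algebra_simps)

lemma poly_ring_ring: "ring (poly_ring n)"
  using poly_ring_cring by (rule cring.axioms)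

lemma poly_ring_a_inv:
  assumes "f \<in> carrier (poly_ring n)" shows "\<ominus>\<^bsub>poly_ring n\<^esub> f = - f"
proof -
  interpret ring "poly_ring n :: 'a mpoly ring" by (rule poly_ring_ring)
  show ?thesis
    using assms by (intro minus_equality) (auto simp: carrier_poly_ring monomial_span_uminus)
qed

lemma ideal_monomial_span_up_closure: "ideal (monomial_span (up_closure n U)) (poly_ring n)"
proof (rule idealI)
  let ?L = "monomial_span (up_closure n U) :: 'a mpoly set"
  interpret ring "poly_ring n :: 'a mpoly ring" by (rule poly_ring_ring)
  have sub: "?L \<subseteq> carrier (poly_ring n)"
    using up_closure_subset by (fastforce simp: carrier_poly_ring monomial_span_def)
  show "subgroup ?L (add_monoid (poly_ring n))"
  proof (rule add.subgroupI)
    fix f assume f: "f \<in> ?L"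
    then show "\<ominus>\<^bsub>poly_ring n\<^esub> f \<in> ?L"
      using sub by (subst poly_ring_a_inv) (auto simp: monomial_span_uminus)
  next
    show "?L \<noteq> {}" using monomial_span_zero by blast
  qed (use sub in \<open>auto intro: monomial_span_add\<close>)
  have add: "v + w \<in> up_closure n U" if "v \<in> exponents n" "w \<in> up_closure n U" for v w
    using that up_closure_subset
    by (intro up_closure_upward[OF that(2)]) (auto simp: exp_le_iff_add exponents_add_iff)
  fix f g assume f: "f \<in> ?L" and g: "g \<in> carrier (poly_ring n :: 'a mpoly ring)"
  show "g \<otimes>\<^bsub>poly_ring n\<^esub> f \<in> ?L"
    using monomial_span_mult[of g "exponents n" f] f g add by (auto simp: carrier_poly_ring)
  then show "f \<otimes>\<^bsub>poly_ring n\<^esub> g \<in> ?L"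
    by (simp add: mult.commute)
qed (rule poly_ring_ring)

lemma sum_singles: "(\<Sum>k\<in>Poly_Mapping.keys f. Poly_Mapping.single k (Poly_Mapping.lookup f k)) = f"
proof (rule poly_mapping_eqI)
  fix k
  show "Poly_Mapping.lookup (\<Sum>k\<in>Poly_Mapping.keys f.
          Poly_Mapping.single k (Poly_Mapping.lookup f k)) k = Poly_Mapping.lookup f k"
    by (auto simp: lookup_sum lookup_single when_def in_keys_iff)
qed

lemma ideal_sum_closed:
  assumes "ideal L (poly_ring n)" "\<And>a. a \<in> A \<Longrightarrow> f a \<in> L"
  shows "sum f A \<in> L"
proof -
  interpret ideal L "poly_ring n" by fact
  show ?thesis
    using assms(2)
  proof (induction A rule: infinite_finite_induct)
    case (insert a A)
    then show ?case using additive_subgroup.a_closed[OF additive_subgroup_axioms, of "f a" "sum f A"] by simp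
  qed (use additive_subgroup.zero_closed[OF additive_subgroup_axioms] in simp_all)
qed

text \<open>The span is an ideal containing the generators. Conversely, a term with exponent
  \<open>w + u\<close>, \<open>u\<close> in \<open>U\<close>, is a term with exponent
  \<open>w\<close> times a generator, and a polynomial is the finite sum of its terms.\<close>

lemma Idl_monom_image:
  assumes "U \<subseteq> exponents n"
  shows "Idl\<^bsub>poly_ring n\<^esub> (monom ` U) = (monomial_span (up_closure n U) :: ('k::field) mpoly set)"
proof
  interpret R: ring "poly_ring n :: 'k mpoly ring" by (rule poly_ring_ring)
  have U: "monom ` U \<subseteq> carrier (poly_ring n :: 'k mpoly ring)"
    using assms by (auto simp: carrier_poly_ring)
  show "Idl\<^bsub>poly_ring n\<^esub> (monom ` U) \<subseteq> (monomial_span (up_closure n U) :: 'k mpoly set)"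
    using up_closure_superset[OF assms]
    by (intro R.genideal_minimal ideal_monomial_span_up_closure) auto
  let ?L = "Idl\<^bsub>poly_ring n\<^esub> (monom ` U) :: 'k mpoly set"
  have L: "ideal ?L (poly_ring n)"
    by (rule R.genideal_ideal[OF U])
  interpret L: ideal ?L "poly_ring n" by (rule L)
  have "Poly_Mapping.single v c \<in> ?L" if v: "v \<in> up_closure n U" for v c
  proof -
    obtain u w where u: "u \<in> U" "v = w + u" and w: "w \<in> exponents n"
      using v by (auto simp: up_closure_def exp_le_iff_add exponents_add_iff)
    have "Poly_Mapping.single w c \<in> carrier (poly_ring n :: 'k mpoly ring)"
      using w by (simp add: carrier_poly_ring monomial_span_def)
    moreover have "monom u \<in> ?L"
      using R.genideal_self[OF U] u by blast
    ultimately have "Poly_Mapping.single w c * monom u \<in> ?L"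
      using L.I_l_closed by fastforce
    then show ?thesis
      by (simp add: u monom_def mult_single)
  qed
  then have "(\<Sum>k\<in>Poly_Mapping.keys f. Poly_Mapping.single k (Poly_Mapping.lookup f k)) \<in> ?L"
    if "f \<in> monomial_span (up_closure n U)" for f
    using that by (intro ideal_sum_closed[OF L]) (auto simp: monomial_span_def)
  then show "monomial_span (up_closure n U) \<subseteq> ?L"
    by (simp add: sum_singles subset_iff)
qed

section \<open>Degrees, and Dickson's lemma by extraction of subsequences\<close>

lemma mon_degree_eq_sum:
  "finite K \<Longrightarrow> Poly_Mapping.keys u \<subseteq> K \<Longrightarrow> mon_degree u = (\<Sum>k\<in>K. Poly_Mapping.lookup u k)"
  unfolding mon_degree_def by (rule sum.mono_neutral_left) (auto simp: in_keys_iff)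

lemma mon_degree_add: "mon_degree (u + v) = mon_degree u + mon_degree v"
proof -
  let ?K = "Poly_Mapping.keys u \<union> Poly_Mapping.keys v"
  show ?thesis
    using keys_add[of u v]
    by (simp add: mon_degree_eq_sum[of ?K] lookup_add sum.distrib)
qed

lemma mon_degree_eq_0_iff: "mon_degree u = 0 \<longleftrightarrow> u = 0"
  by (auto simp: mon_degree_def in_keys_iff) (auto simp: poly_mapping_eq_iff fun_eq_iff)

lemma exp_le_imp_mon_degree_less: "exp_le u v \<Longrightarrow> u \<noteq> v \<Longrightarrow> mon_degree u < mon_degree v"
  using mon_degree_eq_0_iff by (fastforce simp: exp_le_iff_add mon_degree_add)

text \<open>Every sequence has a monotone subsequence. If that one decreases, it is constant from
  the index of its least value on, and a constant tail is increasing.\<close>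

lemma nat_seq_incseq_subseq:
  fixes s :: "nat \<Rightarrow> nat"
  obtains g where "strict_mono g" "incseq (s \<circ> g)"
proof -
  obtain g where g: "strict_mono g" "monoseq (\<lambda>m. s (g m))"
    using seq_monosub by blast
  show ?thesis
  proof (cases "incseq (\<lambda>m. s (g m))")
    case True
    then show ?thesis using that g by (simp add: comp_def)
  next
    case False
    then have dec: "decseq (\<lambda>m. s (g m))"
      using g(2) by (simp add: monoseq_iff)
    obtain N where N: "\<And>m. s (g N) \<le> s (g m)"
      using ex_has_least_nat[of "\<lambda>_. True" 0 "\<lambda>m. s (g m)"] by blast
    have "s (g (N + m)) = s (g N)" for m
      using N[of "N + m"] dec by (simp add: decseq_def order_antisym)
    then have "incseq (s \<circ> (\<lambda>m. g (N + m)))"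
      by (simp add: incseq_def)
    moreover have "strict_mono (\<lambda>m. g (N + m))"
      using g(1) by (simp add: strict_mono_def)
    ultimately show ?thesis using that by blast
  qed
qed

text \<open>Extraction is repeated once per index in \<open>K\<close>; increasing sequences stay
  increasing when passing to a further subsequence.\<close>

lemma incseq_subseq_finite:
  fixes s :: "'a \<Rightarrow> nat \<Rightarrow> nat"
  assumes "finite K"
  shows "\<exists>g. strict_mono g \<and> (\<forall>k\<in>K. incseq (s k \<circ> g))"
  using assms
proof (induction K)
  case empty
  show ?case by (auto intro: strict_mono_id)
next
  case (insert k K)
  then obtain g where g: "strict_mono g" "\<forall>k\<in>K. incseq (s k \<circ> g)" by blast
  obtain h where h: "strict_mono h" "incseq ((s k \<circ> g) \<circ> h)"
    by (rule nat_seq_incseq_subseq)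
  have "incseq ((s j \<circ> g) \<circ> h)" if "j \<in> K" for j
    using g(2) that strict_mono_mono[OF h(1)] by (auto simp: incseq_def mono_def)
  then show ?case
    using g(1) h by (intro exI[of _ "g \<circ> h"]) (simp add: comp_assoc strict_mono_o del: o_apply)
qed

text \<open>An infinite set of minimal exponents contains an injective sequence. Along a subsequence
  all \<open>n\<close> coordinates increase, so one member divides a later one; minimality makes
  them equal, against injectivity.\<close>

lemma Dickson_finite_min_exps:
  assumes "W \<subseteq> exponents n" shows "finite (min_exps W)"
proof (rule ccontr)
  assume "infinite (min_exps W)"
  then obtain f :: "nat \<Rightarrow> _" where f: "inj f" "range f \<subseteq> min_exps W"
    using infinite_countable_subset by blast
  obtain g where g: "strict_mono g"
    "\<forall>k\<in>{1..n}. incseq ((\<lambda>m. Poly_Mapping.lookup (f m) k) \<circ> g)"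
    using incseq_subseq_finite[of "{1..n}" "\<lambda>k m. Poly_Mapping.lookup (f m) k"] by auto
  have f': "f m \<in> W" "\<And>v. v \<in> W \<Longrightarrow> exp_le v (f m) \<Longrightarrow> v = f m" for m
    using f(2) by (auto simp: min_exps_def)
  have "exp_le (f (g 0)) (f (g 1))"
    unfolding exp_le_def
  proof
    fix k
    show "Poly_Mapping.lookup (f (g 0)) k \<le> Poly_Mapping.lookup (f (g 1)) k"
    proof (cases "k \<in> {1..n}")
      case True
      then show ?thesis using g(2) by (auto simp: incseq_def)
    next
      case False
      then show ?thesis using f'(1)[of "g 0"] assms by (auto simp: exponents_iff)
    qed
  qed
  then have "f (g 0) = f (g 1)"
    using f' by blast
  then have "g 0 = g 1"
    using f(1) by (simp add: inj_eq)
  then show False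
    using g(1) by (simp add: strict_mono_eq)
qed

text \<open>A divisor of \<open>w\<close> in \<open>W\<close> of least degree is minimal, because a
  proper divisor has strictly smaller degree.\<close>

lemma min_exps_below:
  assumes "w \<in> W" obtains u where "u \<in> min_exps W" "exp_le u w"
proof -
  obtain u where u: "u \<in> W" "exp_le u w"
    and least: "\<And>v. v \<in> W \<Longrightarrow> exp_le v w \<Longrightarrow> mon_degree u \<le> mon_degree v"
    using ex_has_least_nat[of "\<lambda>u. u \<in> W \<and> exp_le u w" w mon_degree] assms by auto
  have "v = u" if "v \<in> W" "exp_le v u" for v
    using least[of v] that exp_le_trans[OF that(2) u(2)] exp_le_imp_mon_degree_less[OF that(2)]
    by fastforce
  then show ?thesis using that u by (auto simp: min_exps_def)
qed

section \<open>Minimal monomial generators\<close>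

lemma up_closure_min_exps:
  assumes "up_closure n W = W" shows "up_closure n (min_exps W) = W"
proof
  have "min_exps W \<subseteq> W" by (auto simp: min_exps_def)
  then show "up_closure n (min_exps W) \<subseteq> W"
    using assms unfolding up_closure_def by blast
  show "W \<subseteq> up_closure n (min_exps W)"
  proof
    fix w assume w: "w \<in> W"
    with assms have "w \<in> exponents n" using up_closure_subset by blast
    then show "w \<in> up_closure n (min_exps W)"
      using min_exps_below[OF w] by (auto simp: up_closure_def)
  qed
qed

text \<open>A minimal exponent lies above some generator; as that generator is in the closure too,
  minimality identifies the two.\<close>

lemma min_exps_subset_generators:
  assumes "U \<subseteq> exponents n" shows "min_exps (up_closure n U) \<subseteq> U"
  using up_closure_superset[OF assms] by (auto simp: min_exps_def up_closure_def)

text \<open>Justifies the definite description in \<open>min_generators\<close>: the minimal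
  monomials generate, and they are contained in every generating set of monomials. This yields both
  their irredundancy and their uniqueness.\<close>

lemma min_generators_monomial_span:
  assumes W: "up_closure n W = W"
  shows "min_generators n (monomial_span W) = (monom ` min_exps W :: ('k::field) mpoly set)"
  unfolding min_generators_def
proof (rule the_equality)
  have WE: "W \<subseteq> exponents n" using W up_closure_subset by blast
  have mE: "min_exps W \<subseteq> exponents n" using WE by (auto simp: min_exps_def)
  have gen: "Idl\<^bsub>poly_ring n\<^esub> (monom ` min_exps W) = (monomial_span W :: 'k mpoly set)"
    by (simp add: Idl_monom_image[OF mE] up_closure_min_exps[OF W])
  have contains: "min_exps W \<subseteq> U"
    if "U \<subseteq> exponents n" "Idl\<^bsub>poly_ring n\<^esub> (monom ` U) = (monomial_span W :: 'k mpoly set)" for U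
    using that min_exps_subset_generators[of U n] by (simp add: Idl_monom_image monomial_span_eq_iff)
  have subset_image: "\<exists>U. C = monom ` U \<and> U \<subseteq> exponents n"
    if "C \<subseteq> monomials n" for C :: "'k mpoly set"
    using that by (auto simp: monomials_eq subset_image_iff)
  show "finite (monom ` min_exps W :: 'k mpoly set) \<and>
    monom ` min_exps W \<subseteq> (monomials n :: 'k mpoly set) \<and>
    Idl\<^bsub>poly_ring n\<^esub> (monom ` min_exps W) = (monomial_span W :: 'k mpoly set) \<and>
    (\<forall>C. C \<subset> monom ` min_exps W \<longrightarrow> Idl\<^bsub>poly_ring n\<^esub> C \<noteq> (monomial_span W :: 'k mpoly set))"
  proof (intro conjI allI impI notI)
    show "monom ` min_exps W \<subseteq> (monomials n :: 'k mpoly set)"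
      using mE by (auto simp: monomials_eq)
    fix C :: "'k mpoly set"
    assume C: "C \<subset> monom ` min_exps W" "Idl\<^bsub>poly_ring n\<^esub> C = (monomial_span W :: 'k mpoly set)"
    then have "C \<subseteq> monom ` exponents n"
      using mE by (meson image_mono order_trans psubset_imp_subset)
    then have "C \<subseteq> monomials n"
      by (simp add: monomials_eq)
    then obtain U where "C = monom ` U" "U \<subseteq> exponents n"
      using subset_image by blast
    have "min_exps W \<subseteq> U"
      using contains[OF \<open>U \<subseteq> exponents n\<close>] C(2) \<open>C = monom ` U\<close> by simp
    then have "monom ` min_exps W \<subseteq> C"
      using \<open>C = monom ` U\<close> by (simp add: image_mono)
    then show False using C(1) by (simp add: less_le_not_le)
  qed (use Dickson_finite_min_exps[OF WE] gen in auto)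
  fix B :: "'k mpoly set"
  assume B: "finite B \<and> B \<subseteq> monomials n \<and> Idl\<^bsub>poly_ring n\<^esub> B = (monomial_span W :: 'k mpoly set) \<and>
    (\<forall>C. C \<subset> B \<longrightarrow> Idl\<^bsub>poly_ring n\<^esub> C \<noteq> (monomial_span W :: 'k mpoly set))"
  then obtain U where U: "B = monom ` U" "U \<subseteq> exponents n"
    using subset_image[of B] by auto
  then have "monom ` min_exps W \<subseteq> B"
    using B contains[OF U(2)] by (simp add: image_mono)
  \<comment> \<open>A strict inclusion would contradict the irredundancy of \<open>B\<close>, since
    the minimal monomials already generate.\<close>
  then show "B = monom ` min_exps W"
    using B gen by (metis psubsetI)
qed

section \<open>The degree reverse lexicographic order and the initial ideal\<close>

lemma drl_less_total:
  assumes "u \<noteq> v" shows "drl_less u v \<or> drl_less v u"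
proof (cases "mon_degree u = mon_degree v")
  case True
  let ?D = "{k. Poly_Mapping.lookup u k \<noteq> Poly_Mapping.lookup v k}"
  have "finite ?D"
    by (rule finite_subset[of _ "Poly_Mapping.keys u \<union> Poly_Mapping.keys v"]) (auto simp: in_keys_iff)
  moreover have "?D \<noteq> {}"
    using assms by (auto simp: poly_mapping_eq_iff fun_eq_iff)
  \<comment> \<open>The last place of difference exists because both supports are finite.\<close>
  ultimately obtain k where "k \<in> ?D" "\<forall>l>k. l \<notin> ?D"
    using Max_in[of ?D] Max_ge[of ?D] by (meson leD)
  then have "Poly_Mapping.lookup u k \<noteq> Poly_Mapping.lookup v k"
    and "\<forall>l>k. Poly_Mapping.lookup u l = Poly_Mapping.lookup v l"
    by simp_all
  then show ?thesis
    using True unfolding drl_less_def by (metis linorder_neqE_nat)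
qed (auto simp: drl_less_def)

lemma drl_less_irrefl: "\<not> drl_less u u"
  by (simp add: drl_less_def)

lemma drl_less_trans:
  assumes "drl_less u v" "drl_less v w" shows "drl_less u w"
proof (cases "mon_degree u = mon_degree v \<and> mon_degree v = mon_degree w")
  case True
  then obtain k l where
    k: "Poly_Mapping.lookup u k > Poly_Mapping.lookup v k"
       "\<And>m. m > k \<Longrightarrow> Poly_Mapping.lookup u m = Poly_Mapping.lookup v m" and
    l: "Poly_Mapping.lookup v l > Poly_Mapping.lookup w l"
       "\<And>m. m > l \<Longrightarrow> Poly_Mapping.lookup v m = Poly_Mapping.lookup w m"
    using assms by (auto simp: drl_less_def)
  \<comment> \<open>The later of the two deciding places decides between \<open>u\<close> and
    \<open>w\<close>: there at least one comparison is strict and the other is strict or an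
    equality.\<close>
  have "Poly_Mapping.lookup u (max k l) > Poly_Mapping.lookup w (max k l)"
    using k(1) k(2)[of l] l(1) l(2)[of k] by (cases k l rule: linorder_cases) auto
  then show ?thesis
    using True k(2) l(2) unfolding drl_less_def by (intro disjI2 conjI exI[of _ "max k l"]) auto
qed (use assms in \<open>auto simp: drl_less_def\<close>)

text \<open>Discharges the definite description in \<open>lead_exp\<close>: a finite nonempty set
  has a greatest element for a transitive total relation, and irreflexivity makes it unique.\<close>

lemma lead_exp_in_keys:
  assumes "f \<noteq> 0" shows "lead_exp f \<in> Poly_Mapping.keys f"
proof -
  have "\<exists>u\<in>Poly_Mapping.keys f. \<forall>v\<in>Poly_Mapping.keys f. v \<noteq> u \<longrightarrow> drl_less v u"
  proof (rule Finite_Set.bex_greatest_element)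
    show "transp_on (Poly_Mapping.keys f) drl_less"
      using drl_less_trans by (rule transp_onI)
    show "totalp_on (Poly_Mapping.keys f) drl_less"
      using drl_less_total by (rule totalp_onI)
  qed (use assms in auto)
  moreover have "u = v"
    if "\<forall>w\<in>Poly_Mapping.keys f. w \<noteq> u \<longrightarrow> drl_less w u" "u \<in> Poly_Mapping.keys f"
       "\<forall>w\<in>Poly_Mapping.keys f. w \<noteq> v \<longrightarrow> drl_less w v" "v \<in> Poly_Mapping.keys f" for u v
  proof (rule ccontr)
    assume "u \<noteq> v"
    then have "drl_less u v" "drl_less v u" using that by auto
    then show False using drl_less_trans drl_less_irrefl by blast
  qed
  ultimately have "\<exists>!u. u \<in> Poly_Mapping.keys f \<and>
      (\<forall>v\<in>Poly_Mapping.keys f. v \<noteq> u \<longrightarrow> drl_less v u)"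
    by blast
  from theI'[OF this] show ?thesis
    by (simp add: lead_exp_def)
qed

text \<open>Here \<open>W\<close> consists of all multiples of leading exponents; from now on it
  stands for the initial ideal.\<close>

lemma initial_ideal_eq_monomial_span:
  fixes I :: "('k::field) mpoly set"
  assumes "I \<subseteq> carrier (poly_ring n)"
  obtains W where "up_closure n W = W" "initial_ideal n I = (monomial_span W :: 'k mpoly set)"
proof
  let ?U = "lead_exp ` (I - {0})"
  have U: "?U \<subseteq> exponents n"
    using assms lead_exp_in_keys by (fastforce simp: carrier_poly_ring monomial_span_def)
  show "initial_ideal n I = monomial_span (up_closure n ?U)"
    unfolding initial_ideal_def Idl_monom_image[OF U, symmetric]
    by (rule arg_cong[of _ _ "genideal _"]) auto
  show "up_closure n (up_closure n ?U) = up_closure n ?U"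
    by (rule up_closure_idem)
qed

section \<open>The ideals \<open>J_ideal\<close> and \<open>J_tilde\<close> as monomial
  spans\<close>

lemma up_closure_Int_exponents:
  assumes "up_closure n W = W" "m \<le> n"
  shows "up_closure m (W \<inter> exponents m) = W \<inter> exponents m"
proof
  show "W \<inter> exponents m \<subseteq> up_closure m (W \<inter> exponents m)"
    by (simp add: up_closure_superset)
  show "up_closure m (W \<inter> exponents m) \<subseteq> W \<inter> exponents m"
    using assms exponents_mono[OF assms(2)] by (fastforce simp: up_closure_def)
qed

lemma Var_power: "(Var k :: ('k::field) mpoly) ^ m = monom (Poly_Mapping.single k m)"
  by (induction m) (simp_all add: Var_def monom_def mult_single single_add[symmetric])

lemma prod_monom: "(\<Prod>a\<in>A. monom (f a) :: ('k::field) mpoly) = monom (\<Sum>a\<in>A. f a)"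
  by (induction A rule: infinite_finite_induct) (simp_all add: monom_def mult_single)

lemma sum_singles_superset:
  assumes "finite K" "Poly_Mapping.keys f \<subseteq> K"
  shows "(\<Sum>k\<in>K. Poly_Mapping.single k (Poly_Mapping.lookup f k)) = f"
proof -
  have "(\<Sum>k\<in>Poly_Mapping.keys f. Poly_Mapping.single k (Poly_Mapping.lookup f k)) =
        (\<Sum>k\<in>K. Poly_Mapping.single k (Poly_Mapping.lookup f k))"
    using assms by (intro sum.mono_neutral_left) (auto simp: in_keys_iff)
  then show ?thesis by (simp add: sum_singles)
qed

text \<open>A variable beyond \<open>s\<close> occurs with positive exponent, so its factor is a
  positive power of 0. The bound is \<open>{..s}\<close> because the substitution leaves index 0
  alone.\<close>

lemma prod_truncated_vars:
  "(\<Prod>k\<in>Poly_Mapping.keys u. (if s < k then 0 else Var k) ^ Poly_Mapping.lookup u k) =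
    (if Poly_Mapping.keys u \<subseteq> {..s} then monom u else 0 :: ('k::field) mpoly)"
proof (cases "Poly_Mapping.keys u \<subseteq> {..s}")
  case True
  then have "(\<Prod>k\<in>Poly_Mapping.keys u. (if s < k then 0 else Var k) ^ Poly_Mapping.lookup u k) =
    (\<Prod>k\<in>Poly_Mapping.keys u. monom (Poly_Mapping.single k (Poly_Mapping.lookup u k)) :: 'k mpoly)"
    by (intro prod.cong) (auto simp: Var_power)
  then show ?thesis using True by (simp add: prod_monom sum_singles)
next
  case False
  then show ?thesis by (auto simp: not_le in_keys_iff zero_power intro!: prod_zero)
qed

lemma substitute_monom:
  "substitute \<sigma> (monom u) = (\<Prod>k\<in>Poly_Mapping.keys u. \<sigma> k ^ Poly_Mapping.lookup u k)"
  by (simp add: substitute_def) (simp add: monom_def)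

lemma substitute_truncate_in_monomial_span:
  assumes "p \<in> monomial_span W" "W \<subseteq> exponents n"
  shows "substitute (\<lambda>k. if s < k then 0 else Var k) p \<in>
    (monomial_span (W \<inter> exponents s) :: ('k::field) mpoly set)"
  unfolding substitute_def prod_truncated_vars
proof -
  let ?t = "\<lambda>u. Poly_Mapping.single 0 (Poly_Mapping.lookup p u) *
    (if Poly_Mapping.keys u \<subseteq> {..s} then monom u else 0 :: 'k mpoly)"
  have "?t u \<in> monomial_span (W \<inter> exponents s)" if "u \<in> Poly_Mapping.keys p" for u
  proof (cases "Poly_Mapping.keys u \<subseteq> {..s}")
    case True
    have "u \<in> W" using that assms(1) by (auto simp: monomial_span_def)
    \<comment> \<open>Index 0 is excluded by \<open>W \<subseteq> exponents n\<close>, which turns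
      \<open>{..s}\<close> into \<open>{1..s}\<close>.\<close>
    with True assms(2) have "u \<in> W \<inter> exponents s" by (fastforce simp: exponents_def)
    then show ?thesis using True by (simp add: monomial_span_def monom_def mult_single)
  qed simp
  then show "sum ?t (Poly_Mapping.keys p) \<in> monomial_span (W \<inter> exponents s)"
    using keys_sum[of ?t "Poly_Mapping.keys p"] by (fastforce simp: monomial_span_def)
qed

lemma J_ideal_eq_monomial_span:
  fixes I :: "('k::field) mpoly set"
  assumes W: "up_closure n W = W" and I: "initial_ideal n I = monomial_span W"
  shows "J_ideal n I i = monomial_span (W \<inter> exponents (n - i))"
proof -
  let ?s = "n - i"
  let ?\<sigma> = "\<lambda>k. if ?s < k then 0 else Var k :: 'k mpoly"
  let ?X = "substitute ?\<sigma> ` monomial_span W"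
  let ?V = "W \<inter> exponents ?s"
  interpret R: ring "poly_ring ?s :: 'k mpoly ring" by (rule poly_ring_ring)
  have upV: "up_closure ?s ?V = ?V"
    by (rule up_closure_Int_exponents[OF W]) simp
  have span: "Idl\<^bsub>poly_ring ?s\<^esub> (monom ` ?V) = (monomial_span ?V :: 'k mpoly set)"
    by (subst Idl_monom_image) (simp_all add: upV)
  have idealV: "ideal (monomial_span ?V :: 'k mpoly set) (poly_ring ?s)"
    using ideal_monomial_span_up_closure[of ?s ?V] by (simp add: upV)
  have X: "?X \<subseteq> monomial_span ?V"
    using substitute_truncate_in_monomial_span up_closure_subset[of n W] by (auto simp: W)
  have Xc: "?X \<subseteq> carrier (poly_ring ?s)"
    using X by (auto simp: carrier_poly_ring monomial_span_def)
  \<comment> \<open>The substitution fixes the monomials in the first \<open>n - i\<close>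
    variables, so all generators of the span are themselves images.\<close>
  have "monom u \<in> ?X" if "u \<in> ?V" for u
  proof -
    have "substitute ?\<sigma> (monom u) = monom u"
      using that by (auto simp: substitute_monom prod_truncated_vars exponents_def)
    then show ?thesis using that by (intro image_eqI[of _ _ "monom u"]) auto
  qed
  then have "monomial_span ?V \<subseteq> Idl\<^bsub>poly_ring ?s\<^esub> ?X"
    unfolding span[symmetric] using R.genideal_self[OF Xc]
    by (intro R.genideal_minimal R.genideal_ideal Xc) blast
  moreover have "Idl\<^bsub>poly_ring ?s\<^esub> ?X \<subseteq> monomial_span ?V"
    by (rule R.genideal_minimal[OF idealV X])
  ultimately show ?thesis
    by (simp add: J_ideal_def I)
qed

text \<open>Evaluating at 1 erases the exponent at \<open>s\<close>: the factor 1 is the monomial of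
  \<open>single s 0\<close>, which is the zero exponent.\<close>

lemma substitute_one_monom:
  "substitute (\<lambda>k. if k = s then 1 else Var k) (monom u) =
    (monom (Poly_Mapping.update s 0 u) :: ('k::field) mpoly)"
proof -
  have "substitute (\<lambda>k. if k = s then 1 else Var k) (monom u) =
    (\<Prod>k\<in>Poly_Mapping.keys u.
       monom (Poly_Mapping.single k (Poly_Mapping.lookup (Poly_Mapping.update s 0 u) k)) :: 'k mpoly)"
    unfolding substitute_monom
    by (intro prod.cong) (auto simp: Var_power lookup_update monom_def)
  also have "\<dots> = monom (Poly_Mapping.update s 0 u)"
    by (simp add: prod_monom sum_singles_superset keys_update)
  finally show ?thesis .
qed

lemma J_tilde_eq_monomial_span:
  fixes I :: "('k::field) mpoly set"
  assumes "up_closure n W = W" "initial_ideal n I = monomial_span W"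
  shows "J_tilde n I i = monomial_span (up_closure (n - i)
           (Poly_Mapping.update (n - i) 0 ` (W \<inter> exponents (n - i))))"
proof -
  let ?s = "n - i"
  have "J_ideal n I i \<inter> monomials ?s = monom ` (W \<inter> exponents ?s)"
    by (auto simp: J_ideal_eq_monomial_span[OF assms] monomials_eq)
  then have "substitute (\<lambda>k. if k = ?s then 1 else Var k) ` (J_ideal n I i \<inter> monomials ?s) =
      monom ` Poly_Mapping.update ?s 0 ` (W \<inter> exponents ?s)"
    by (simp add: image_image substitute_one_monom)
  moreover have "Poly_Mapping.update ?s 0 ` (W \<inter> exponents ?s) \<subseteq> exponents ?s"
    by (auto simp: exponents_iff lookup_update)
  ultimately show ?thesis
    by (simp add: J_tilde_def Idl_monom_image)
qed

section \<open>Graded components of the quotient and finiteness of \<open>c_inv\<close>\<close>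

lemma quot_component_monomial_span:
  fixes V T s
  defines "L \<equiv> monomial_span V :: ('k::field) mpoly set"
  assumes L: "ideal L (poly_ring s)" and T: "V \<subseteq> T" "T \<subseteq> exponents s"
  shows "quot_component (poly_ring s) (monomial_span T) L r \<noteq> {L} \<longleftrightarrow> (\<exists>u\<in>T - V. mon_degree u = r)"
proof -
  interpret L: ideal L "poly_ring s" by (rule L)
  have coset: "L +>\<^bsub>poly_ring s\<^esub> f = L \<longleftrightarrow> f \<in> L" if "f \<in> monomial_span T" for f
  proof -
    have "f \<in> carrier (poly_ring s)"
      using that T by (auto simp: carrier_poly_ring monomial_span_def)
    then show ?thesis
      using L.a_coset_join1 L.a_coset_join2 L.a_subgroup by metis
  qed
  \<comment> \<open>The zero polynomial is homogeneous of every degree, so the trivial coset always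
    belongs to the component, and differing from \<open>{L}\<close> means having another
    coset.\<close>
  have "0 \<in> monomial_span T" "homogeneous r 0" "0 \<in> L"
    by (simp_all add: homogeneous_def L_def)
  then have "L \<in> quot_component (poly_ring s) (monomial_span T) L r"
    using coset[of 0] unfolding quot_component_def by fastforce
  then have "quot_component (poly_ring s) (monomial_span T) L r \<noteq> {L} \<longleftrightarrow>
      (\<exists>c \<in> quot_component (poly_ring s) (monomial_span T) L r. c \<noteq> L)"
    by auto
  also have "\<dots> \<longleftrightarrow> (\<exists>f\<in>monomial_span T. homogeneous r f \<and> f \<notin> L)"
    using coset by (auto simp: quot_component_def)
  also have "\<dots> \<longleftrightarrow> (\<exists>u\<in>T - V. mon_degree u = r)"
  \<comment> \<open>A homogeneous polynomial outside \<open>L\<close> has a key outside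
    \<open>V\<close>, of degree \<open>r\<close>; conversely a single monomial serves as the
    polynomial.\<close>
  proof
    assume "\<exists>f\<in>monomial_span T. homogeneous r f \<and> f \<notin> L"
    then show "\<exists>u\<in>T - V. mon_degree u = r"
      unfolding L_def monomial_span_def homogeneous_def by blast
  next
    assume "\<exists>u\<in>T - V. mon_degree u = r"
    then obtain u where "u \<in> T - V" "mon_degree u = r" by blast
    then show "\<exists>f\<in>monomial_span T. homogeneous r f \<and> f \<notin> L"
      by (intro bexI[of _ "monom u"]) (auto simp: L_def homogeneous_def)
  qed
  finally show ?thesis .
qed

text \<open>A finite supremum lies below some natural number by the Archimedean property. The empty
  set is covered as well: its supremum is minus infinity and every \<open>N\<close> is a
  bound.\<close>

lemma SUP_ereal_nat_less_top_iff:
  "(SUP r\<in>A. ereal (real r)) < \<infinity> \<longleftrightarrow> (\<exists>N::nat. \<forall>r\<in>A. r \<le> N)"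
proof
  assume "(SUP r\<in>A. ereal (real r)) < \<infinity>"
  then obtain N :: nat where N: "(SUP r\<in>A. ereal (real r)) < ereal (real N)"
    using less_PInf_Ex_of_nat by auto
  have "r \<le> N" if "r \<in> A" for r
    using order_le_less_trans[OF SUP_upper[OF that, of "\<lambda>r. ereal (real r)"] N] by simp
  then show "\<exists>N. \<forall>r\<in>A. r \<le> N" by blast
next
  assume "\<exists>N. \<forall>r\<in>A. r \<le> N"
  then obtain N where "\<forall>r\<in>A. r \<le> N" by blast
  then have "(SUP r\<in>A. ereal (real r)) \<le> ereal (real N)"
    by (intro SUP_least) auto
  then show "(SUP r\<in>A. ereal (real r)) < \<infinity>"
    using order_le_less_trans by fastforce
qed

lemma c_inv_less_top_iff:
  fixes I :: "('k::field) mpoly set"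
  assumes W: "up_closure n W = W" and I: "initial_ideal n I = monomial_span W"
  shows "c_inv n I i < \<infinity> \<longleftrightarrow> (\<exists>N. \<forall>u \<in> up_closure (n - i)
      (Poly_Mapping.update (n - i) 0 ` (W \<inter> exponents (n - i))) - W. mon_degree u \<le> N)"
proof -
  let ?s = "n - i"
  let ?V = "W \<inter> exponents ?s"
  let ?T = "up_closure ?s (Poly_Mapping.update ?s 0 ` ?V)"
  have upV: "up_closure ?s ?V = ?V"
    by (rule up_closure_Int_exponents[OF W]) simp
  have "exp_le (Poly_Mapping.update ?s 0 u) u" for u
    by (simp add: exp_le_def lookup_update)
  then have "?V \<subseteq> ?T"
    by (auto simp: up_closure_def)
  moreover have "ideal (monomial_span ?V :: 'k mpoly set) (poly_ring ?s)"
    using ideal_monomial_span_up_closure[of ?s ?V] by (simp add: upV)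
  ultimately have "quot_component (poly_ring ?s) (J_tilde n I i) (J_ideal n I i) r \<noteq> {J_ideal n I i}
      \<longleftrightarrow> (\<exists>u\<in>?T - ?V. mon_degree u = r)" for r
    unfolding J_tilde_eq_monomial_span[OF assms] J_ideal_eq_monomial_span[OF assms]
    by (intro quot_component_monomial_span up_closure_subset)
  \<comment> \<open>Elements of \<open>?T\<close> already use only the first \<open>n - i\<close>
    variables, so membership in \<open>?V\<close> and in \<open>W\<close> agree on them.\<close>
  moreover have "?T - ?V = ?T - W"
    using up_closure_subset by blast
  ultimately have "{r. quot_component (poly_ring ?s) (J_tilde n I i) (J_ideal n I i) r \<noteq> {J_ideal n I i}}
      = mon_degree ` (?T - W)"
    by auto
  then show ?thesis
    unfolding c_inv_def by (simp add: SUP_ereal_nat_less_top_iff del: less_ereal.simps ereal_infty_less)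
qed

section \<open>The combinatorial criterion on exponents\<close>

lemma lookup_le_mon_degree: "Poly_Mapping.lookup u k \<le> mon_degree u"
proof (cases "k \<in> Poly_Mapping.keys u")
  case True
  then show ?thesis
    unfolding mon_degree_def by (intro member_le_sum) auto
qed (simp add: in_keys_iff)

text \<open>The criterion without lists: clearing coordinate \<open>s\<close> replaces deleting it,
  support in \<open>{1..s - 1}\<close> replaces the shorter length, and comparison away from
  \<open>j\<close> replaces the projection deleting \<open>j\<close>.\<close>

lemma saturation_degree_bounded_iff:
  assumes W: "up_closure n W = W" and s: "1 \<le> s" "s \<le> n"
  shows "(\<exists>N. \<forall>u \<in> up_closure s (Poly_Mapping.update s 0 ` (W \<inter> exponents s)) - W. mon_degree u \<le> N) \<longleftrightarrow>
    (\<forall>a \<in> Poly_Mapping.update s 0 ` (min_exps W \<inter> exponents s) - min_exps W \<inter> exponents (s - 1).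
      \<forall>j\<in>{1..s - 1}. \<exists>b \<in> min_exps W \<inter> exponents (s - 1).
        \<forall>k. k \<noteq> j \<longrightarrow> Poly_Mapping.lookup b k \<le> Poly_Mapping.lookup a k)"
    (is "?bounded \<longleftrightarrow> ?covered")
proof
  assume ?bounded
  then obtain N where N: "\<And>u. u \<in> up_closure s (Poly_Mapping.update s 0 ` (W \<inter> exponents s)) \<Longrightarrow>
      u \<notin> W \<Longrightarrow> mon_degree u \<le> N"
    by blast
  show ?covered
  proof (intro ballI)
    fix a j
    assume a: "a \<in> Poly_Mapping.update s 0 ` (min_exps W \<inter> exponents s) - min_exps W \<inter> exponents (s - 1)"
      and j: "j \<in> {1..s - 1}"
    \<comment> \<open>The power \<open>Suc N\<close> pushes the degree beyond the bound, which
      forces \<open>u\<close> into \<open>W\<close>.\<close>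
    define u where "u = a + Poly_Mapping.single j (Suc N)"
    from a obtain g where g: "g \<in> W" "g \<in> exponents s" "a = Poly_Mapping.update s 0 g"
      by (auto simp: min_exps_def)
    have "a \<in> exponents (s - 1)"
      unfolding exponents_iff
    proof (intro allI impI)
      fix k assume "k \<notin> {1..s - 1}"
      then have "k = s \<or> k \<notin> {1..s}" by auto
      then show "Poly_Mapping.lookup a k = 0"
        using g(2) by (auto simp: g(3) lookup_update exponents_iff)
    qed
    then have u: "u \<in> exponents (s - 1)"
      using j unfolding u_def exponents_add_iff by (simp add: exponents_def)
    moreover have "exponents (s - 1) \<subseteq> exponents s"
      by (rule exponents_mono) simp
    moreover have "exp_le a u"
      by (simp add: u_def exp_le_def lookup_add)
    ultimately have "u \<in> up_closure s (Poly_Mapping.update s 0 ` (W \<inter> exponents s))"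
      using g by (auto simp: up_closure_def)
    moreover have "\<not> mon_degree u \<le> N"
      by (simp add: u_def mon_degree_add) (simp add: mon_degree_def)
    ultimately have "u \<in> W" using N by blast
    then obtain b where b: "b \<in> min_exps W" "exp_le b u"
      by (rule min_exps_below)
    have "\<forall>k. k \<noteq> j \<longrightarrow> Poly_Mapping.lookup b k \<le> Poly_Mapping.lookup a k"
      using b(2) by (auto simp: exp_le_def u_def lookup_add lookup_single when_def split: if_splits)
    \<comment> \<open>A divisor of \<open>u\<close> cannot involve variable \<open>s\<close>,
      because \<open>u\<close> does not.\<close>
    then show "\<exists>b \<in> min_exps W \<inter> exponents (s - 1).
        \<forall>k. k \<noteq> j \<longrightarrow> Poly_Mapping.lookup b k \<le> Poly_Mapping.lookup a k"
      using b exponents_downward[OF b(2) u] by blast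
  qed
next
  assume cov: ?covered
  have fin: "finite (min_exps W)"
    using Dickson_finite_min_exps up_closure_subset[of n W] by (simp add: W)
  \<comment> \<open>A crude common bound for all exponents in all minimal generators; the sum makes
    sense by Dickson's lemma.\<close>
  define D where "D = (\<Sum>g\<in>min_exps W. mon_degree g)"
  have D: "Poly_Mapping.lookup g k \<le> D" if "g \<in> min_exps W" for g k
    using member_le_sum[OF that _ fin, of mon_degree] lookup_le_mon_degree[of g k]
    by (simp add: D_def)
  have "mon_degree u \<le> s * D"
    if u: "u \<in> up_closure s (Poly_Mapping.update s 0 ` (W \<inter> exponents s))" "u \<notin> W" for u
  proof -
    have uE: "u \<in> exponents s" using u(1) by (simp add: up_closure_def)
    have not_above: "\<not> exp_le g u" if "g \<in> min_exps W" for g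
    proof
      assume "exp_le g u"
      moreover have "u \<in> exponents n" using uE exponents_mono[OF s(2)] by blast
      moreover have "g \<in> W" using that by (simp add: min_exps_def)
      ultimately have "u \<in> up_closure n W" by (auto simp: up_closure_def)
      then show False using u(2) W by simp
    qed
    obtain w where w: "w \<in> W" "w \<in> exponents s" "exp_le (Poly_Mapping.update s 0 w) u"
      using u(1) by (auto simp: up_closure_def)
    obtain g where g: "g \<in> min_exps W" "exp_le g w"
      using min_exps_below[OF w(1)] .
    define a where "a = Poly_Mapping.update s 0 g"
    have "g \<in> exponents s" by (rule exponents_downward[OF g(2) w(2)])
    have au: "exp_le a u"
    proof (rule exp_le_trans[OF _ w(3)])
      show "exp_le a (Poly_Mapping.update s 0 w)"
        using g(2) by (simp add: a_def exp_le_def lookup_update)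
    qed
    \<comment> \<open>This puts \<open>a\<close> in the set difference over which the covering
      hypothesis ranges.\<close>
    then have "a \<notin> min_exps W"
      using not_above by blast
    with g(1) \<open>g \<in> exponents s\<close> have a:
      "a \<in> Poly_Mapping.update s 0 ` (min_exps W \<inter> exponents s) - min_exps W \<inter> exponents (s - 1)"
      by (auto simp: a_def)
    have "Poly_Mapping.lookup u k \<le> D" if k: "k \<in> {1..s}" for k
    proof (rule ccontr)
      assume large: "\<not> Poly_Mapping.lookup u k \<le> D"
      have "\<exists>b \<in> min_exps W. \<forall>l. l \<noteq> k \<longrightarrow> Poly_Mapping.lookup b l \<le> Poly_Mapping.lookup a l"
      proof (cases "k = s")
        case True
        \<comment> \<open>For the last coordinate \<open>g\<close> itself serves, as
          \<open>a\<close> and \<open>g\<close> differ only at \<open>s\<close>.\<close>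
        then show ?thesis using g(1) by (auto simp: a_def lookup_update)
      next
        case False
        then have "k \<in> {1..s - 1}" using k by auto
        then show ?thesis using cov a by blast
      qed
      then obtain b where b: "b \<in> min_exps W"
        "\<And>l. l \<noteq> k \<Longrightarrow> Poly_Mapping.lookup b l \<le> Poly_Mapping.lookup a l"
        by blast
      \<comment> \<open>At \<open>k\<close> the entry of \<open>b\<close> is at most
        \<open>D\<close>, hence below that of \<open>u\<close>; elsewhere \<open>b\<close> lies
        below \<open>a\<close>, which lies below \<open>u\<close>.\<close>
      have "exp_le b u"
        unfolding exp_le_def
      proof
        fix l
        show "Poly_Mapping.lookup b l \<le> Poly_Mapping.lookup u l"
        proof (cases "l = k")
          case True
          then show ?thesis using D[OF b(1), of k] large by simp
        next
          case False
          then show ?thesis using b(2)[OF False] au by (auto simp: exp_le_def intro: order_trans)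
        qed
      qed
      then show False using not_above b(1) by blast
    qed
    then have "(\<Sum>k\<in>{1..s}. Poly_Mapping.lookup u k) \<le> s * D"
      using sum_bounded_above[of "{1..s}" "Poly_Mapping.lookup u" D] by simp
    then show ?thesis
      using uE mon_degree_eq_sum[of "{1..s}" u] by (simp add: exponents_def)
  qed
  then show ?bounded by blast
qed

section \<open>Translation between lists and exponents\<close>

definition exp_of_list :: "nat list \<Rightarrow> (nat \<Rightarrow>\<^sub>0 nat)" where
  "exp_of_list v = (\<Sum>k=1..length v. Poly_Mapping.single k (v ! (k - 1)))"

lemma xpow_eq_monom: "xpow v = monom (exp_of_list v)"
  by (simp add: xpow_def exp_of_list_def Var_power prod_monom)

lemma lookup_exp_of_list:
  "Poly_Mapping.lookup (exp_of_list v) k = (if k \<in> {1..length v} then v ! (k - 1) else 0)"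
  by (auto simp: exp_of_list_def lookup_sum lookup_single when_def)

text \<open>Equal length matters, since trailing zeros of a list leave no trace in its
  exponent.\<close>

lemma exp_of_list_inject:
  assumes "length v = length w" "exp_of_list v = exp_of_list w" shows "v = w"
proof (rule nth_equalityI)
  fix k assume "k < length v"
  then show "v ! k = w ! k"
    using assms lookup_exp_of_list[of v "Suc k"] lookup_exp_of_list[of w "Suc k"] by simp
qed (rule assms)

text \<open>Applied with \<open>U\<close> the minimal exponents, this identifies each
  \<open>E_set\<close> with the minimal exponents supported on an initial segment of the
  variables.\<close>

lemma exp_of_list_image: "exp_of_list ` {v. length v = m \<and> exp_of_list v \<in> U} = U \<inter> exponents m"
proof
  show "exp_of_list ` {v. length v = m \<and> exp_of_list v \<in> U} \<subseteq> U \<inter> exponents m"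
    by (auto simp: exponents_iff lookup_exp_of_list)
  show "U \<inter> exponents m \<subseteq> exp_of_list ` {v. length v = m \<and> exp_of_list v \<in> U}"
  proof
    fix u assume u: "u \<in> U \<inter> exponents m"
    let ?v = "map (\<lambda>k. Poly_Mapping.lookup u (Suc k)) [0..<m]"
    have "exp_of_list ?v = u"
      using u by (auto simp: lookup_exp_of_list exponents_iff intro!: poly_mapping_eqI)
    then show "u \<in> exp_of_list ` {v. length v = m \<and> exp_of_list v \<in> U}"
      using u by (intro image_eqI[of _ _ ?v]) auto
  qed
qed

lemma exp_of_list_proj_last:
  "length v = s \<Longrightarrow> exp_of_list (proj s v) = Poly_Mapping.update s 0 (exp_of_list v)"
  by (rule poly_mapping_eqI) (auto simp: lookup_exp_of_list lookup_update proj_def)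

lemma nth_proj:
  "j \<in> {1..length v} \<Longrightarrow> k < length v - 1 \<Longrightarrow> proj j v ! k = v ! (if k < j - 1 then k else Suc k)"
  by (auto simp: proj_def nth_append)

lemma length_proj: "j \<in> {1..length v} \<Longrightarrow> length (proj j v) = length v - 1"
  by (auto simp: proj_def)

lemma vec_le_proj_iff:
  assumes "length b = m" "length a = m" "j \<in> {1..m}"
  shows "vec_le (proj j b) (proj j a) \<longleftrightarrow>
    (\<forall>k. k \<noteq> j \<longrightarrow> Poly_Mapping.lookup (exp_of_list b) k \<le> Poly_Mapping.lookup (exp_of_list a) k)"
proof -
  have "vec_le (proj j b) (proj j a) \<longleftrightarrow> (\<forall>k<m - 1. proj j b ! k \<le> proj j a ! k)"
    using assms by (simp add: vec_le_def list_all2_conv_all_nth length_proj)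
  also have "\<dots> \<longleftrightarrow> (\<forall>k\<in>{1..m} - {j}. b ! (k - 1) \<le> a ! (k - 1))"
  proof
    assume le: "\<forall>k<m - 1. proj j b ! k \<le> proj j a ! k"
    show "\<forall>k\<in>{1..m} - {j}. b ! (k - 1) \<le> a ! (k - 1)"
    proof
      fix k assume k: "k \<in> {1..m} - {j}"
      show "b ! (k - 1) \<le> a ! (k - 1)"
      proof (cases "k < j")
        case True
        then have "k - 1 < m - 1" "k - 1 < j - 1" using k assms(3) by auto
        then show ?thesis using assms le[rule_format, of "k - 1"] k by (simp add: nth_proj)
      next
        case False
        \<comment> \<open>Coordinate \<open>k\<close> sits at position \<open>k - 1\<close> and
          moves to \<open>k - 2\<close> once the earlier coordinate \<open>j\<close> is deleted;
          \<open>k > j\<close> gives \<open>k \<ge> 2\<close>, so the truncated subtraction is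
          exact.\<close>
        then have "k - 2 < m - 1" "\<not> k - 2 < j - 1" "Suc (k - 2) = k - 1"
          using k assms(3) by auto
        then show ?thesis using assms le[rule_format, of "k - 2"] by (simp add: nth_proj)
      qed
    qed
  next
    assume le: "\<forall>k\<in>{1..m} - {j}. b ! (k - 1) \<le> a ! (k - 1)"
    show "\<forall>k<m - 1. proj j b ! k \<le> proj j a ! k"
    proof (intro allI impI)
      fix k assume k: "k < m - 1"
      show "proj j b ! k \<le> proj j a ! k"
      proof (cases "k < j - 1")
        case True
        then have "Suc k \<in> {1..m} - {j}" using k by auto
        with True show ?thesis using k assms le[rule_format, of "Suc k"] by (simp add: nth_proj)
      next
        case False
        then have "Suc (Suc k) \<in> {1..m} - {j}" using k by auto
        with False show ?thesis using k assms le[rule_format, of "Suc (Suc k)"] by (simp add: nth_proj)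
      qed
    qed
  qed
  \<comment> \<open>Indices outside \<open>{1..m}\<close> add no condition, both entries being 0
    there.\<close>
  also have "\<dots> \<longleftrightarrow> (\<forall>k. k \<noteq> j \<longrightarrow>
      Poly_Mapping.lookup (exp_of_list b) k \<le> Poly_Mapping.lookup (exp_of_list a) k)"
    using assms by (auto simp: lookup_exp_of_list)
  finally show ?thesis .
qed

theorem lemma4p1:
  fixes I :: "('k::field) mpoly set" and n i :: nat
  assumes "n \<ge> 1"
    and "homogeneous_ideal n I"
    and "I \<noteq> carrier (poly_ring n)"
    and "ereal (real i) \<le> min (krull_dim (poly_ring n Quot I)) (ereal (real (n - 1)))"
  shows "c_inv n I i < \<infinity> \<longleftrightarrow>
    (\<forall>a \<in> proj (n - i) ` E_set n I i - E_set n I (i + 1). \<forall>j \<in> {1..n - i - 1}.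
       \<exists>b \<in> E_set n I (i + 1). vec_le (proj j b) (proj j a))"
proof -
  define s where "s = n - i"
  have s: "1 \<le> s" "s \<le> n"
    using assms(1,4) by (auto simp: s_def)
  have "ideal I (poly_ring n)"
    using assms(2) by (simp add: homogeneous_ideal_def)
  then have "I \<subseteq> carrier (poly_ring n)"
    by (meson additive_subgroup.a_subset ideal.axioms(1))
  then obtain W where W: "up_closure n W = W" "initial_ideal n I = (monomial_span W :: 'k mpoly set)"
    by (rule initial_ideal_eq_monomial_span)
  have E: "E_set n I m = {v. length v = n - m \<and> exp_of_list v \<in> min_exps W}" for m
    by (auto simp: E_set_def W(2) min_generators_monomial_span[OF W(1)] xpow_eq_monom)
  \<comment> \<open>\<open>A\<close> is \<open>E_set n I i\<close> and \<open>B\<close> is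
    \<open>E_set n I (i + 1)\<close>, as \<open>n - (i + 1) = s - 1\<close>.\<close>
  define A where "A = {v. length v = s \<and> exp_of_list v \<in> min_exps W}"
  define B where "B = {v. length v = s - 1 \<and> exp_of_list v \<in> min_exps W}"
  have imB: "exp_of_list ` B = min_exps W \<inter> exponents (s - 1)"
    unfolding B_def by (rule exp_of_list_image)
  have imA: "Poly_Mapping.update s 0 ` (min_exps W \<inter> exponents s) = exp_of_list ` proj s ` A"
    unfolding exp_of_list_image[symmetric] A_def[symmetric] image_image
    by (rule image_cong) (auto simp: A_def exp_of_list_proj_last)
  have len: "length v = s - 1" if "v \<in> proj s ` A \<union> B" for v
    using that s by (auto simp: A_def B_def length_proj)
  \<comment> \<open>Images commute with set difference only under injectivity, available because all
    lists involved have length \<open>s - 1\<close>.\<close>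
  have diff: "exp_of_list ` proj s ` A - exp_of_list ` B = exp_of_list ` (proj s ` A - B)"
  proof -
    have "inj_on exp_of_list (proj s ` A \<union> B)"
      by (rule inj_onI) (metis exp_of_list_inject len)
    then show ?thesis unfolding inj_on_def by blast
  qed
  have "c_inv n I i < \<infinity> \<longleftrightarrow>
    (\<forall>a \<in> exp_of_list ` (proj s ` A - B). \<forall>j\<in>{1..s - 1}. \<exists>b \<in> exp_of_list ` B.
        \<forall>k. k \<noteq> j \<longrightarrow> Poly_Mapping.lookup b k \<le> Poly_Mapping.lookup a k)"
    unfolding c_inv_less_top_iff[OF W, of i] s_def[symmetric]
      saturation_degree_bounded_iff[OF W(1) s] imB[symmetric] imA diff ..
  also have "\<dots> \<longleftrightarrow> (\<forall>a \<in> proj s ` A - B. \<forall>j\<in>{1..s - 1}. \<exists>b \<in> B. vec_le (proj j b) (proj j a))"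
  proof -
    have "(\<forall>k. k \<noteq> j \<longrightarrow> Poly_Mapping.lookup (exp_of_list b) k \<le> Poly_Mapping.lookup (exp_of_list a) k)
        \<longleftrightarrow> vec_le (proj j b) (proj j a)" if "a \<in> proj s ` A" "b \<in> B" "j \<in> {1..s - 1}" for a b j
      using that len by (intro vec_le_proj_iff[symmetric, of _ "s - 1"]) auto
    then show ?thesis
      by (simp cong: ball_cong_simp bex_cong_simp)
  qed
  finally show ?thesis
    by (simp add: E A_def B_def s_def)
qed

end
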